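(* Let $\kappa>0$ and let $X$ be a complete CAT($\kappa$) space with $\operatorname{diam}(X)\le\frac{\pi-\varepsilon}{2\sqrt{\kappa}}$ for some $\varepsilon\in(0,\pi/2)$, and put $R=(\pi-2\varepsilon)\tan(\varepsilon)$. Let $K$ be a nonempty closed convex subset of $X$, and let $T$ be a generalized multivalued hybrid mapping of type II from $K$ to the family of nonempty compact subsets of $K$, satisfying either (i) $a_2(x)=0$ and $\frac{2k_2(x)}{1-a_3(x)}<\frac{R}{2}$ for all $x\in K$, or (ii) $a_3(x)=0$ and $\frac{2k_1(x)}{1-a_2(x)}<\frac{R}{2}$ for all $x\in K$. If moreover $k=\sup_{x\in K}\frac{a_1(x)+k_1(x)}{1-k_2(x)}<1$, then $F(T)\neq\emptyset$.
   Context: $(X,d)$ is a metric space. A CAT($\kappa$) space ($\kappa>0$) is a metric space in which any two points at distance less than $D_\kappa=\pi/\sqrt{\kappa}$ are joined by a geodesic, and in which every geodesic triangle of perimeter less than $2D_\kappa$ satisfies $d(p,q)\le d(\bar p,\bar q)$ for all points $p,q$ of the triangle and their comparison points $\bar p,\bar q$ in a comparison triangle in the model surface $M_\kappa^2$ (the sphere $S^2$ with its distance multiplied by $1/\sqrt{\kappa}$). A subset is convex if it contains every geodesic segment joining any two of its points. $F(T)=\{x\in K: x\in Tx\}$. For a set $B$, $d(x,B)=d(B,x)=\inf\{d(x,y):y\in B\}$, and $H(A,B)=\max\{\sup_{x\in A}d(x,B),\sup_{x\in B}d(x,A)\}$ is the Hausdorff metric. $T$ is a generalized multivalued hybrid mapping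 of type II on $K$ (with coefficient functions $a_1,a_2,a_3,k_1,k_2:K\to[0,1]$) if $a_1(x)+a_2(x)+a_3(x)<1$, $2k_1(x)<1-a_2(x)$ and $2k_2(x)<1-a_3(x)$ for all $x\in K$, and $$H^2(Tx,Ty)\le a_1(x)d^2(x,y)+a_2(x)d^2(Tx,y)+a_3(x)d^2(x,Ty)+k_1(x)d^2(Tx,x)+k_2(x)d^2(Ty,y)$$ for all $x,y\in K$. *)

theory Defs
  imports "HOL-Analysis.Analysis"
begin

(* The geodesic notions take a carrier M and a distance d explicitly, because they are
   needed both for the space itself (UNIV, dist) and for the model sphere with its
   angular distance, which is not the distance that real^3 induces on it. *)

definition geodesic_path ::
  "'a set \<Rightarrow> ('a \<Rightarrow> 'a \<Rightarrow> real) \<Rightarrow> (real \<Rightarrow> 'a) \<Rightarrow> real \<Rightarrow> 'a \<Rightarrow> 'a \<Rightarrow> bool"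
  where "geodesic_path M d c l x y \<longleftrightarrow>
    0 \<le> l \<and> c ` {0..l} \<subseteq> M \<and> c 0 = x \<and> c l = y \<and>
    (\<forall>s\<in>{0..l}. \<forall>t\<in>{0..l}. d (c s) (c t) = \<bar>s - t\<bar>)"

definition geodesic_segment ::
  "'a set \<Rightarrow> ('a \<Rightarrow> 'a \<Rightarrow> real) \<Rightarrow> 'a \<Rightarrow> 'a \<Rightarrow> 'a set \<Rightarrow> bool"
  where "geodesic_segment M d x y S \<longleftrightarrow>
    (\<exists>c l. geodesic_path M d c l x y \<and> S = c ` {0..l})"

definition geodesically_convex :: "'a::metric_space set \<Rightarrow> bool"
  where "geodesically_convex K \<longleftrightarrow>
    (\<forall>x\<in>K. \<forall>y\<in>K. \<forall>S. geodesic_segment UNIV dist x y S \<longrightarrow> S \<subseteq> K)"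

(* A geodesic triangle consists of its vertices p, q, r together with a choice of
   sides A from p to q, B from q to r and C from r to p. *)

definition geodesic_triangle ::
  "'a set \<Rightarrow> ('a \<Rightarrow> 'a \<Rightarrow> real) \<Rightarrow> 'a \<Rightarrow> 'a \<Rightarrow> 'a \<Rightarrow> 'a set \<Rightarrow> 'a set \<Rightarrow> 'a set \<Rightarrow> bool"
  where "geodesic_triangle M d p q r A B C \<longleftrightarrow>
    geodesic_segment M d p q A \<and> geodesic_segment M d q r B \<and> geodesic_segment M d r p C"

definition model_diameter :: "real \<Rightarrow> real"
  where "model_diameter \<kappa> = pi / sqrt \<kappa>"

definition model_surface :: "(real^3) set"
  where "model_surface = sphere 0 1"

definition model_dist :: "real \<Rightarrow> real^3 \<Rightarrow> real^3 \<Rightarrow> real"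
  where "model_dist \<kappa> u v = arccos (u \<bullet> v) / sqrt \<kappa>"

(* x' is a comparison point for x if both lie on corresponding sides, at the same distance
   from corresponding endpoints.  A vertex, or any point lying on several sides, is
   considered with respect to each of these sides. *)

definition comparison_point ::
  "real \<Rightarrow> ('a \<Rightarrow> 'a \<Rightarrow> real) \<Rightarrow> 'a \<Rightarrow> 'a \<Rightarrow> 'a \<Rightarrow> 'a set \<Rightarrow> 'a set \<Rightarrow> 'a set \<Rightarrow>
    real^3 \<Rightarrow> real^3 \<Rightarrow> real^3 \<Rightarrow> (real^3) set \<Rightarrow> (real^3) set \<Rightarrow> (real^3) set \<Rightarrow>
    'a \<Rightarrow> real^3 \<Rightarrow> bool"
  where "comparison_point \<kappa> d p q r A B C p' q' r' A' B' C' x x' \<longleftrightarrow>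
    x \<in> A \<and> x' \<in> A' \<and> model_dist \<kappa> p' x' = d p x \<or>
    x \<in> B \<and> x' \<in> B' \<and> model_dist \<kappa> q' x' = d q x \<or>
    x \<in> C \<and> x' \<in> C' \<and> model_dist \<kappa> r' x' = d r x"

definition comparison_triangle ::
  "real \<Rightarrow> ('a \<Rightarrow> 'a \<Rightarrow> real) \<Rightarrow> 'a \<Rightarrow> 'a \<Rightarrow> 'a \<Rightarrow>
    real^3 \<Rightarrow> real^3 \<Rightarrow> real^3 \<Rightarrow> (real^3) set \<Rightarrow> (real^3) set \<Rightarrow> (real^3) set \<Rightarrow> bool"
  where "comparison_triangle \<kappa> d p q r p' q' r' A' B' C' \<longleftrightarrow>
    geodesic_triangle model_surface (model_dist \<kappa>) p' q' r' A' B' C' \<and>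
    model_dist \<kappa> p' q' = d p q \<and> model_dist \<kappa> q' r' = d q r \<and> model_dist \<kappa> r' p' = d r p"

(* For perimeter less than 2 D_kappa a comparison triangle exists and is unique up to
   isometry, so quantifying over all of them amounts to choosing one. *)

definition CAT_space :: "real \<Rightarrow> 'a set \<Rightarrow> ('a \<Rightarrow> 'a \<Rightarrow> real) \<Rightarrow> bool"
  where "CAT_space \<kappa> M d \<longleftrightarrow>
    Metric_space M d \<and>
    (\<forall>x\<in>M. \<forall>y\<in>M. d x y < model_diameter \<kappa> \<longrightarrow> (\<exists>S. geodesic_segment M d x y S)) \<and>
    (\<forall>p q r A B C p' q' r' A' B' C'.
      geodesic_triangle M d p q r A B C \<longrightarrow>
      d p q + d q r + d r p < 2 * model_diameter \<kappa> \<longrightarrow>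
      comparison_triangle \<kappa> d p q r p' q' r' A' B' C' \<longrightarrow>
      (\<forall>x y x' y'.
        comparison_point \<kappa> d p q r A B C p' q' r' A' B' C' x x' \<longrightarrow>
        comparison_point \<kappa> d p q r A B C p' q' r' A' B' C' y y' \<longrightarrow>
        d x y \<le> model_dist \<kappa> x' y'))"

(* Meaningful for nonempty bounded sets, on which the real suprema are genuine. *)

definition hausdorff_distance :: "'a::metric_space set \<Rightarrow> 'a set \<Rightarrow> real"
  where "hausdorff_distance A B = max (SUP x\<in>A. infdist x B) (SUP x\<in>B. infdist x A)"

definition generalized_hybrid_II ::
  "'a::metric_space set \<Rightarrow> ('a \<Rightarrow> 'a set) \<Rightarrow>
    ('a \<Rightarrow> real) \<Rightarrow> ('a \<Rightarrow> real) \<Rightarrow> ('a \<Rightarrow> real) \<Rightarrow> ('a \<Rightarrow> real) \<Rightarrow> ('a \<Rightarrow> real) \<Rightarrow> bool"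
  where "generalized_hybrid_II K T a1 a2 a3 k1 k2 \<longleftrightarrow>
    (\<forall>x\<in>K. a1 x \<in> {0..1} \<and> a2 x \<in> {0..1} \<and> a3 x \<in> {0..1} \<and> k1 x \<in> {0..1} \<and> k2 x \<in> {0..1}) \<and>
    (\<forall>x\<in>K. a1 x + a2 x + a3 x < 1 \<and> 2 * k1 x < 1 - a2 x \<and> 2 * k2 x < 1 - a3 x) \<and>
    (\<forall>x\<in>K. \<forall>y\<in>K.
      (hausdorff_distance (T x) (T y))\<^sup>2 \<le>
        a1 x * (dist x y)\<^sup>2 + a2 x * (infdist y (T x))\<^sup>2 + a3 x * (infdist x (T y))\<^sup>2
        + k1 x * (infdist x (T x))\<^sup>2 + k2 x * (infdist y (T y))\<^sup>2)"

definition fixed_points :: "'a set \<Rightarrow> ('a \<Rightarrow> 'a set) \<Rightarrow> 'a set"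
  where "fixed_points K T = {x \<in> K. x \<in> T x}"

end

theory Submission
  imports Defs
begin

text \<open>
  The fixed point is the limit of a Picard orbit \<open>x (Suc n) \<in> T (x n)\<close> in which each
  point is a nearest point of the value at its predecessor; compactness of the values
  provides such orbits. Along an orbit the displacement \<open>infdist (x n) (T (x n))\<close> equals
  \<open>dist (x n) (x (Suc n))\<close>, so it is enough that displacements decrease geometrically: the
  orbit is then Cauchy, and its limit \<open>z\<close> lies in the closed set \<open>K\<close>.

  The decrease comes from the hybrid inequality at two consecutive points \<open>p\<close> and
  \<open>q \<in> T p\<close>. Three of the five squared distances on its right-hand side are displacements
  or \<open>dist p q\<close>, one vanishes because \<open>q \<in> T p\<close>, and the remaining one,
  \<open>infdist p (T q)\<close>, is a distance across two steps, which would spoil the estimate. The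
  inequality is not symmetric in its two arguments, so there is a choice of order, and the
  two alternatives in the theorem call for different orders: if \<open>a3 = 0\<close>, the pair
  \<open>(p, q)\<close> removes the two-step distance, and if \<open>a2 = 0\<close>, the pair \<open>(q, p)\<close> does. In
  the first case the ratio of consecutive squared displacements is at most
  \<open>(a1 + k1) / (1 - k2)\<close> at \<open>p\<close>, which the supremum controls directly. In the second it is
  at most \<open>(a1 + k2) / (1 - k1)\<close> at \<open>q\<close>, with the roles of \<open>k1\<close> and \<open>k2\<close>
  exchanged; but if \<open>k < 1\<close> denotes the supremum, then
  \<open>a1 + k1 + k2 \<le> k (1 - k2) + k2 = k + (1 - k) k2 \<le> (1 + k) / 2\<close>, because
  \<open>k2 \<le> 1/2\<close>, and this bounds the exchanged ratio by \<open>(1 + k) / 2\<close> as well. Both cases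
  are \<open>hybrid_displacement_decrease\<close>.

  Finally, in the hybrid inequality at \<open>z\<close> and \<open>x n\<close> all terms on the right
  tend to zero except those with coefficients \<open>a2\<close> and \<open>k1\<close>, whose squared distances tend
  to the squared displacement of \<open>z\<close>. The limit bounds this square by \<open>a2 + k1 < 1\<close> times
  itself, so it is zero (\<open>hybrid_orbit_limit_fixed\<close>).
\<close>

section \<open>Nearest points and the Hausdorff distance\<close>

lemma infdist_le_hausdorff_distance:
  fixes A B :: "'a::metric_space set"
  assumes "bounded A" "B \<noteq> {}" "x \<in> A"
  shows "infdist x B \<le> hausdorff_distance A B"
proof -
  obtain b where b: "b \<in> B" using assms(2) by blast
  obtain M where M: "\<And>y. y \<in> A \<Longrightarrow> dist b y \<le> M"
    using assms(1) bounded_any_center by blast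
  have "infdist y B \<le> M" if "y \<in> A" for y
    using infdist_le[OF b, of y] M[OF that] by (simp add: dist_commute)
  then have "bdd_above ((\<lambda>y. infdist y B) ` A)"
    by (rule bdd_aboveI2)
  then have "infdist x B \<le> (SUP y\<in>A. infdist y B)"
    using assms(3) by (rule cSUP_upper2) simp
  then show ?thesis
    unfolding hausdorff_distance_def by simp
qed

lemma hausdorff_distance_commute: "hausdorff_distance A B = hausdorff_distance B A"
  by (simp add: hausdorff_distance_def max.commute)

lemma compact_attains_infdist:
  fixes A :: "'a::metric_space set"
  assumes "compact A" "A \<noteq> {}"
  obtains y where "y \<in> A" "dist x y = infdist x A"
proof -
  have "continuous_on A (\<lambda>y. dist x y)"
    by (intro continuous_intros)
  then obtain y where y: "y \<in> A" "\<And>w. w \<in> A \<Longrightarrow> dist x y \<le> dist x w"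
    using continuous_attains_inf[OF assms] by blast
  have "dist x y \<le> infdist x A"
    using y(2) assms(2) by (auto simp: infdist_notempty intro: cINF_greatest)
  with infdist_le[OF y(1), of x] show thesis
    using y(1) by (intro that) auto
qed

section \<open>Sequences with geometrically decreasing steps\<close>

text \<open>
  Summing the geometric series of step lengths telescopes: a step of length at most
  \<open>C r^n\<close> is paid for by the decrease of the potential \<open>C r^n / (1 - r)\<close>.
\<close>
lemma geometric_steps_imp_Cauchy:
  fixes x :: "nat \<Rightarrow> 'a::metric_space"
  assumes r: "0 \<le> r" "r < 1"
    and step: "\<And>n. dist (x n) (x (Suc n)) \<le> C * r ^ n"
  shows "Cauchy x"
proof -
  define S where "S n = C * r ^ n / (1 - r)" for n
  have S_step: "S n = C * r ^ n + S (Suc n)" for n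
    using r by (simp add: S_def field_simps)
  have "0 \<le> dist (x 0) (x (Suc 0))" by simp
  also have "\<dots> \<le> C" using step[of 0] by simp
  finally have S_nonneg: "0 \<le> S n" for n
    using r by (simp add: S_def)
  have tail: "dist (x n) (x (n + j)) \<le> S n - S (n + j)" for n j
  proof (induction j)
    case (Suc j)
    have "dist (x n) (x (n + Suc j)) \<le> dist (x n) (x (n + j)) + dist (x (n + j)) (x (Suc (n + j)))"
      by (simp add: dist_triangle)
    with Suc step[of "n + j"] S_step[of "n + j"] show ?case by simp
  qed simp
  have "(\<lambda>n. C / (1 - r) * r ^ n) \<longlonglongrightarrow> C / (1 - r) * 0"
    using r by (intro tendsto_intros LIMSEQ_realpow_zero) auto
  then have "S \<longlonglongrightarrow> 0"
    by (simp add: S_def[abs_def])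
  show ?thesis
    unfolding Cauchy_altdef2
  proof (intro allI impI)
    fix e :: real assume "e > 0"
    then obtain N where N: "S N < e"
      using order_tendstoD(2)[OF \<open>S \<longlonglongrightarrow> 0\<close>] by (meson eventually_happens' sequentially_bot)
    have "dist (x n) (x N) < e" if "n \<ge> N" for n
      using tail[of N "n - N"] S_nonneg[of n] N that by (simp add: dist_commute)
    then show "\<exists>N. \<forall>n\<ge>N. dist (x n) (x N) < e" by blast
  qed
qed

section \<open>The hybrid inequality along an orbit\<close>

lemma generalized_hybrid_IID:
  assumes "generalized_hybrid_II K T a1 a2 a3 k1 k2" "x \<in> K" "y \<in> K"
  shows "(hausdorff_distance (T x) (T y))\<^sup>2 \<le> a1 x * (dist x y)\<^sup>2 + a2 x * (infdist y (T x))\<^sup>2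
      + a3 x * (infdist x (T y))\<^sup>2 + k1 x * (infdist x (T x))\<^sup>2 + k2 x * (infdist y (T y))\<^sup>2"
  using assms by (simp only: generalized_hybrid_II_def)

text \<open>
  The order in which the hybrid inequality is applied to \<open>p\<close> and \<open>q\<close> is chosen so that the
  two-step distance \<open>infdist p (T q)\<close> gets the coefficient zero; the accompanying
  condition on the coefficients says, or implies by \<open>c < 1\<close>, that the terms left over give
  the ratio \<open>c\<close>.
\<close>
lemma hybrid_displacement_decrease:
  fixes T :: "'a::metric_space \<Rightarrow> 'a set"
  assumes hyb: "generalized_hybrid_II K T a1 a2 a3 k1 k2"
    and val: "\<And>x. x \<in> K \<Longrightarrow> T x \<noteq> {} \<and> compact (T x) \<and> T x \<subseteq> K"
    and p: "p \<in> K" and q: "q \<in> T p" and nearest: "dist p q = infdist p (T p)"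
    and c: "c < 1"
    and ratio: "a3 p = 0 \<and> a1 p + k1 p \<le> c * (1 - k2 p) \<or>
                a2 q = 0 \<and> a1 q + k1 q + k2 q \<le> c"
  shows "(infdist q (T q))\<^sup>2 \<le> c * (dist p q)\<^sup>2"
proof -
  have qK: "q \<in> K" using val[OF p] q by blast
  have zero: "infdist q (T p) = 0" using q by simp
  have "infdist q (T q) \<le> hausdorff_distance (T p) (T q)"
    using val[OF p] val[OF qK] q by (intro infdist_le_hausdorff_distance compact_imp_bounded) auto
  then have H: "(infdist q (T q))\<^sup>2 \<le> (hausdorff_distance (T p) (T q))\<^sup>2"
    by (simp add: infdist_nonneg power_mono)
  have range: "k1 q \<ge> 0" "2 * k1 q < 1 - a2 q" "2 * k2 p < 1 - a3 p"
    using hyb p qK unfolding generalized_hybrid_II_def by auto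
  from ratio show ?thesis
  proof
    assume A: "a3 p = 0 \<and> a1 p + k1 p \<le> c * (1 - k2 p)"
    have "(hausdorff_distance (T p) (T q))\<^sup>2 \<le> a1 p * (dist p q)\<^sup>2 + a2 p * (infdist q (T p))\<^sup>2
        + a3 p * (infdist p (T q))\<^sup>2 + k1 p * (infdist p (T p))\<^sup>2 + k2 p * (infdist q (T q))\<^sup>2"
      using generalized_hybrid_IID[OF hyb p qK] .
    then have "(1 - k2 p) * (infdist q (T q))\<^sup>2 \<le> (a1 p + k1 p) * (dist p q)\<^sup>2"
      using H A by (simp add: zero nearest[symmetric] algebra_simps)
    also have "\<dots> \<le> (c * (1 - k2 p)) * (dist p q)\<^sup>2"
      using A by (intro mult_right_mono) auto
    finally have "(1 - k2 p) * (infdist q (T q))\<^sup>2 \<le> (1 - k2 p) * (c * (dist p q)\<^sup>2)"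
      by (simp add: mult_ac)
    moreover have "1 - k2 p > 0" using range A by linarith
    ultimately show ?thesis by (simp only: mult_le_cancel_left_pos)
  next
    assume A: "a2 q = 0 \<and> a1 q + k1 q + k2 q \<le> c"
    have "(hausdorff_distance (T q) (T p))\<^sup>2 \<le> a1 q * (dist q p)\<^sup>2 + a2 q * (infdist p (T q))\<^sup>2
        + a3 q * (infdist q (T p))\<^sup>2 + k1 q * (infdist q (T q))\<^sup>2 + k2 q * (infdist p (T p))\<^sup>2"
      using generalized_hybrid_IID[OF hyb qK p] .
    then have "(1 - k1 q) * (infdist q (T q))\<^sup>2 \<le> (a1 q + k2 q) * (dist p q)\<^sup>2"
      using H A
      by (simp add: zero nearest[symmetric] hausdorff_distance_commute[of "T q"]
          dist_commute[of q] algebra_simps)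
    also have "\<dots> \<le> (c * (1 - k1 q)) * (dist p q)\<^sup>2"
    proof (rule mult_right_mono)
      have "c * k1 q \<le> k1 q" using mult_right_mono[of c 1 "k1 q"] c range by simp
      then show "a1 q + k2 q \<le> c * (1 - k1 q)" using A by (simp add: algebra_simps)
    qed simp
    finally have "(1 - k1 q) * (infdist q (T q))\<^sup>2 \<le> (1 - k1 q) * (c * (dist p q)\<^sup>2)"
      by (simp add: mult_ac)
    moreover have "1 - k1 q > 0" using range A by linarith
    ultimately show ?thesis by (simp only: mult_le_cancel_left_pos)
  qed
qed

text \<open>
  In the limit the coefficient \<open>a2 z + k1 z\<close> multiplies the displacement of \<open>z\<close>, and it is
  below 1 because \<open>k1 z\<close> is less than half of \<open>1 - a2 z\<close>.
\<close>
lemma hybrid_orbit_limit_fixed: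
  fixes T :: "'a::metric_space \<Rightarrow> 'a set"
  assumes hyb: "generalized_hybrid_II K T a1 a2 a3 k1 k2"
    and val: "\<And>x. x \<in> K \<Longrightarrow> T x \<noteq> {} \<and> compact (T x)"
    and xK: "\<And>n. x n \<in> K" and orbit: "\<And>n. x (Suc n) \<in> T (x n)"
    and lim: "x \<longlonglongrightarrow> z" and zK: "z \<in> K"
  shows "z \<in> T z"
proof -
  let ?D = "infdist z (T z)"
  have range: "a3 z \<ge> 0" "k1 z \<ge> 0" "k2 z \<ge> 0" "a1 z + a2 z + a3 z < 1" "2 * k1 z < 1 - a2 z" "a1 z \<ge> 0"
    using hyb zK unfolding generalized_hybrid_II_def by auto
  have bound: "(infdist (x (Suc n)) (T z))\<^sup>2 \<le> a1 z * (dist z (x n))\<^sup>2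
      + a2 z * (infdist (x n) (T z))\<^sup>2 + a3 z * (dist z (x (Suc n)))\<^sup>2
      + k1 z * ?D\<^sup>2 + k2 z * (dist (x n) (x (Suc n)))\<^sup>2" for n
  proof -
    have "infdist (x (Suc n)) (T z) \<le> hausdorff_distance (T (x n)) (T z)"
      using val[OF xK[of n]] val[OF zK] orbit
      by (intro infdist_le_hausdorff_distance compact_imp_bounded) auto
    then have "(infdist (x (Suc n)) (T z))\<^sup>2 \<le> (hausdorff_distance (T z) (T (x n)))\<^sup>2"
      by (simp add: infdist_nonneg power_mono hausdorff_distance_commute[of "T z"])
    also have "\<dots> \<le> a1 z * (dist z (x n))\<^sup>2 + a2 z * (infdist (x n) (T z))\<^sup>2
        + a3 z * (infdist z (T (x n)))\<^sup>2 + k1 z * ?D\<^sup>2 + k2 z * (infdist (x n) (T (x n)))\<^sup>2"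
      using generalized_hybrid_IID[OF hyb zK xK] .
    also have "\<dots> \<le> a1 z * (dist z (x n))\<^sup>2 + a2 z * (infdist (x n) (T z))\<^sup>2
        + a3 z * (dist z (x (Suc n)))\<^sup>2 + k1 z * ?D\<^sup>2 + k2 z * (dist (x n) (x (Suc n)))\<^sup>2"
      using range infdist_le[OF orbit]
      by (intro add_mono mult_left_mono power_mono infdist_nonneg order_refl) auto
    finally show ?thesis .
  qed
  have lim': "(\<lambda>n. x (Suc n)) \<longlonglongrightarrow> z" using lim by (rule LIMSEQ_Suc)
  have "(\<lambda>n. (infdist (x (Suc n)) (T z))\<^sup>2) \<longlonglongrightarrow> ?D\<^sup>2"
    by (intro tendsto_intros lim')
  moreover have "(\<lambda>n. a1 z * (dist z (x n))\<^sup>2 + a2 z * (infdist (x n) (T z))\<^sup>2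
        + a3 z * (dist z (x (Suc n)))\<^sup>2 + k1 z * ?D\<^sup>2 + k2 z * (dist (x n) (x (Suc n)))\<^sup>2)
      \<longlonglongrightarrow> a1 z * (dist z z)\<^sup>2 + a2 z * ?D\<^sup>2 + a3 z * (dist z z)\<^sup>2
        + k1 z * ?D\<^sup>2 + k2 z * (dist z z)\<^sup>2"
    by (intro tendsto_intros lim lim')
  ultimately have "?D\<^sup>2 \<le> a1 z * (dist z z)\<^sup>2 + a2 z * ?D\<^sup>2 + a3 z * (dist z z)\<^sup>2
      + k1 z * ?D\<^sup>2 + k2 z * (dist z z)\<^sup>2"
    by (rule LIMSEQ_le) (use bound in blast)
  then have "(1 - a2 z - k1 z) * ?D\<^sup>2 \<le> 0" by (simp add: algebra_simps)
  moreover have "1 - a2 z - k1 z > 0" using range by linarith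
  ultimately have "?D\<^sup>2 \<le> 0" by (simp add: mult_le_0_iff)
  then have "?D = 0" by simp
  then show ?thesis
    using val[OF zK] in_closed_iff_infdist_zero[of "T z" z] compact_imp_closed by blast
qed

section \<open>Existence of a fixed point\<close>

lemma nearest_orbit_exists:
  fixes T :: "'a::metric_space \<Rightarrow> 'a set"
  assumes "K \<noteq> {}" and val: "\<And>x. x \<in> K \<Longrightarrow> T x \<noteq> {} \<and> compact (T x) \<and> T x \<subseteq> K"
  obtains x :: "nat \<Rightarrow> 'a" where "\<And>n. x n \<in> K" "\<And>n. x (Suc n) \<in> T (x n)"
    "\<And>n. dist (x n) (x (Suc n)) = infdist (x n) (T (x n))"
proof -
  have step: "\<exists>q. q \<in> K \<and> q \<in> T p \<and> dist p q = infdist p (T p)" if pK: "p \<in> K" for p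
  proof -
    obtain q where "q \<in> T p" "dist p q = infdist p (T p)"
      using compact_attains_infdist[of "T p" p] val[OF pK] by metis
    then show ?thesis using val[OF pK] by blast
  qed
  obtain x where "\<forall>n::nat. x n \<in> K \<and>
      (x (Suc n) \<in> T (x n) \<and> dist (x n) (x (Suc n)) = infdist (x n) (T (x n)))"
  proof (atomize_elim, rule dependent_nat_choice)
    show "\<exists>p. p \<in> K" using assms(1) by blast
  qed (rule step)
  then show thesis by (intro that[of x]) auto
qed

theorem theorem3p13:
  fixes \<kappa> \<epsilon> R :: real
    and K :: "'a::complete_space set"
    and T :: "'a \<Rightarrow> 'a set"
    and a1 a2 a3 k1 k2 :: "'a \<Rightarrow> real"
  assumes "\<kappa> > 0"
    and "CAT_space \<kappa> (UNIV :: 'a set) dist"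
    and "0 < \<epsilon>" and "\<epsilon> < pi / 2"
    and "bounded (UNIV :: 'a set)"
    and "diameter (UNIV :: 'a set) \<le> (pi - \<epsilon>) / (2 * sqrt \<kappa>)"
    and "R = (pi - 2 * \<epsilon>) * tan \<epsilon>"
    and "K \<noteq> {}" and "closed K" and "geodesically_convex K"
    and "\<And>x. x \<in> K \<Longrightarrow> T x \<noteq> {} \<and> compact (T x) \<and> T x \<subseteq> K"
    and "generalized_hybrid_II K T a1 a2 a3 k1 k2"
    and "(\<forall>x\<in>K. a2 x = 0 \<and> 2 * k2 x / (1 - a3 x) < R / 2) \<or>
         (\<forall>x\<in>K. a3 x = 0 \<and> 2 * k1 x / (1 - a2 x) < R / 2)"
    and "(SUP x\<in>K. (a1 x + k1 x) / (1 - k2 x)) < 1"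
  shows "fixed_points K T \<noteq> {}"
proof -
  define k where "k = (SUP x\<in>K. (a1 x + k1 x) / (1 - k2 x))"
  define c where "c = (1 + k) / 2"
  note val = assms(11) and hyb = assms(12)
  have range: "0 \<le> a1 x" "a1 x \<le> 1" "0 \<le> k1 x" "k1 x \<le> 1" "0 \<le> k2 x" "2 * k2 x \<le> 1" if "x \<in> K" for x
  proof -
    have "0 \<le> a3 x" "2 * k2 x < 1 - a3 x"
      using hyb that unfolding generalized_hybrid_II_def by auto
    then show "2 * k2 x \<le> 1" by linarith
  qed (use hyb that in \<open>auto simp: generalized_hybrid_II_def\<close>)
  \<comment> \<open>The real supremum is genuine: the numerators are at most 2, the denominators at
    least 1/2.\<close>
  have "(a1 x + k1 x) / (1 - k2 x) \<le> 4" if "x \<in> K" for x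
    using range[OF that] by (simp add: divide_le_eq)
  then have bdd: "bdd_above ((\<lambda>x. (a1 x + k1 x) / (1 - k2 x)) ` K)"
    by (rule bdd_aboveI2)
  have ratio: "a1 x + k1 x \<le> k * (1 - k2 x)" if "x \<in> K" for x
  proof -
    have "(a1 x + k1 x) / (1 - k2 x) \<le> k"
      unfolding k_def using bdd that by (rule cSUP_upper2) simp
    then show ?thesis using range[OF that] by (simp add: divide_le_eq)
  qed
  have k1: "k < 1" using assms(14) by (simp add: k_def)
  have k0: "0 \<le> k"
  proof -
    obtain x where x: "x \<in> K" using assms(8) by blast
    have "0 \<le> k * (1 - k2 x)" using ratio[OF x] range[OF x] by linarith
    then show ?thesis using range[OF x] by (simp add: zero_le_mult_iff)
  qed
  have c: "0 \<le> c" "c < 1" "k \<le> c" using k0 k1 by (auto simp: c_def)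
  have ratio_c: "a1 x + k1 x \<le> c * (1 - k2 x)" if "x \<in> K" for x
    using ratio[OF that] mult_right_mono[OF c(3), of "1 - k2 x"] range[OF that] by linarith
  have sum_c: "a1 x + k1 x + k2 x \<le> c" if "x \<in> K" for x
  proof -
    have "(1 - k) * k2 x \<le> (1 - k) * (1 / 2)"
      using k1 range[OF that] by (intro mult_left_mono) auto
    then show ?thesis using ratio[OF that] by (simp add: c_def algebra_simps)
  qed

  obtain x where xK: "\<And>n. x n \<in> K" and orbit: "\<And>n. x (Suc n) \<in> T (x n)"
    and nearest: "\<And>n. dist (x n) (x (Suc n)) = infdist (x n) (T (x n))"
    using nearest_orbit_exists[of K T] assms(8) val by metis
  have decrease: "dist (x (Suc n)) (x (Suc (Suc n))) \<le> sqrt c * dist (x n) (x (Suc n))" for n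
  proof -
    have "a3 (x n) = 0 \<or> a2 (x (Suc n)) = 0" using assms(13) xK by blast
    then have "a3 (x n) = 0 \<and> a1 (x n) + k1 (x n) \<le> c * (1 - k2 (x n)) \<or>
        a2 (x (Suc n)) = 0 \<and> a1 (x (Suc n)) + k1 (x (Suc n)) + k2 (x (Suc n)) \<le> c"
      using ratio_c[OF xK[of n]] sum_c[OF xK[of "Suc n"]] by argo
    then have "(infdist (x (Suc n)) (T (x (Suc n))))\<^sup>2 \<le> c * (dist (x n) (x (Suc n)))\<^sup>2"
      by (rule hybrid_displacement_decrease[OF hyb _ xK orbit nearest c(2), rotated]) (rule val)
    then have "sqrt ((dist (x (Suc n)) (x (Suc (Suc n))))\<^sup>2) \<le> sqrt (c * (dist (x n) (x (Suc n)))\<^sup>2)"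
      by (simp only: nearest[of "Suc n"] real_sqrt_le_iff)
    then show ?thesis by (simp add: real_sqrt_mult)
  qed
  have "dist (x n) (x (Suc n)) \<le> dist (x 0) (x (Suc 0)) * sqrt c ^ n" for n
  proof (induction n)
    case (Suc n)
    have "sqrt c * dist (x n) (x (Suc n)) \<le> sqrt c * (dist (x 0) (x (Suc 0)) * sqrt c ^ n)"
      using Suc c by (intro mult_left_mono) auto
    with decrease[of n] show ?case by (simp add: mult_ac)
  qed simp
  then have "Cauchy x"
    using c by (intro geometric_steps_imp_Cauchy[of "sqrt c" x]) auto
  then obtain z where z: "x \<longlonglongrightarrow> z"
    using Cauchy_convergent convergent_def by blast
  have "z \<in> K" using closed_sequentially[OF assms(9)] xK z by blast
  moreover have "z \<in> T z"
    using val by (intro hybrid_orbit_limit_fixed[OF hyb _ xK orbit z \<open>z \<in> K\<close>]) blast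
  ultimately show ?thesis unfolding fixed_points_def by blast
qed

end
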